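(* Let $r\in\mathbb{N}_0$, let $a_1,\dots,a_r\in\mathbb{N}_0$ and $a_{r+1}\in\mathbb{N}$, and put $\mathbf{s}=(\{2\}^{a_1},1,\dots,\{2\}^{a_r},1,\{2\}^{a_{r+1}})$. Then for every $n\in\mathbb{N}$, \[ H^\star_n(\mathbf{s})=-\sum_{\mathbf{p}\in\Pi(2a_1+1,\,\dots,\,2a_r+1,\,\overline{2a_{r+1}})}2^{\ell(\mathbf{p})}\,\mathcal{H}_n(\mathbf{p}). \]
   Context: $\mathbb{N}=\{1,2,\dots\}$, $\mathbb{N}_0=\mathbb{N}\cup\{0\}$; for a positive integer $m$, $\overline{m}$ denotes $-m$. For $\mathbf{s}=(s_1,\dots,s_\ell)$ with nonzero integer entries, $H_n(\mathbf{s})=\sum_{n\ge k_1>\cdots>k_\ell\ge1}\prod_{i=1}^\ell \frac{\operatorname{sgn}(s_i)^{k_i}}{k_i^{|s_i|}}$ and $H^\star_n(\mathbf{s})=\sum_{n\ge k_1\ge\cdots\ge k_\ell\ge1}\prod_{i=1}^\ell \frac{\operatorname{sgn}(s_i)^{k_i}}{k_i^{|s_i|}}$, with $H_n(\mathbf{s})=0$ if $n<\ell$ and $H_n(\emptyset)=H^\star_n(\emptyset)=1$. $\{2\}^a$ denotes $a$ copies of $2$. For nonzero integers $a,b$, $a\oplus b=\operatorname{sgn}(a)b+\operatorname{sgn}(b)a$. For a sequence $(s_1,\dots,s_m)$ of nonzero integers, $\Pi(s_1,\dots,s_m)$ is the set of the $2^{m-1}$ indices $s_1\circ\cdots\circ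 s_m$ where each $\circ$ is independently either "," or $\oplus$ (entries joined by $\oplus$ merge into one component); $\ell(\mathbf{p})$ is the number of components. For $\mathbf{p}=(p_1,\dots,p_m)$, $\mathcal{H}_n(\mathbf{p})=\sum_{k=1}^n\frac{\operatorname{sgn}(p_1)^k}{k^{|p_1|}}\frac{\binom{n}{k}}{\binom{n+k}{k}}H_{k-1}(p_2,\dots,p_m)$. *)

theory Defs
  imports Complex_Main
begin

text \<open>
  An index (s_1, ..., s_l) of nonzero integers is an \<open>int list\<close>, a barred entry being a
  negative integer. The summation variables k_1, ..., k_l are likewise collected in a list,
  in the order k_1, ..., k_l, that is, largest first.
\<close>

definition harm_term :: "int list \<Rightarrow> nat list \<Rightarrow> real" where
  "harm_term s ks =
     (\<Prod>i<length s. of_int (sgn (s ! i)) ^ (ks ! i) / real (ks ! i) ^ nat \<bar>s ! i\<bar>)"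

definition mhs :: "nat \<Rightarrow> int list \<Rightarrow> real" where
  "mhs n s =
     (\<Sum>ks | length ks = length s \<and> set ks \<subseteq> {1..n} \<and> sorted_wrt (>) ks. harm_term s ks)"

definition mhs_star :: "nat \<Rightarrow> int list \<Rightarrow> real" where
  "mhs_star n s =
     (\<Sum>ks | length ks = length s \<and> set ks \<subseteq> {1..n} \<and> sorted_wrt (\<ge>) ks. harm_term s ks)"

definition oplus :: "int \<Rightarrow> int \<Rightarrow> int" where
  "oplus a b = sgn a * b + sgn b * a"

text \<open>
  The set \<open>\<Pi>(s\<^sub>1, \<dots>, s\<^sub>m)\<close>: the leftmost \<open>\<circ>\<close> is either a comma, which closes the first component,
  or \<open>oplus\<close>, which merges the first two entries. As \<open>oplus\<close> is associative on nonzero integers,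
  bracketing to the left is harmless. Only \<open>m \<ge> 1\<close> is meaningful; the value at the empty list
  is a dummy.
\<close>

fun merges :: "int list \<Rightarrow> int list set" where
  "merges [] = {}"
| "merges [s] = {[s]}"
| "merges (s # t # ss) = (#) s ` merges (t # ss) \<union> merges (oplus s t # ss)"

text \<open>The sum \<open>\<H>\<^sub>n(p\<^sub>1, \<dots>, p\<^sub>m)\<close>, meaningful for a nonempty index only.\<close>

definition binom_mhs :: "nat \<Rightarrow> int list \<Rightarrow> real" where
  "binom_mhs n p =
     (\<Sum>k=1..n. of_int (sgn (hd p)) ^ k / real k ^ nat \<bar>hd p\<bar>
        * (real (n choose k) / real ((n + k) choose k)) * mhs (k - 1) (tl p))"

end

theory Submission
  imports Defs
begin

text \<open>
  Write \<open>c n k\<close> for the ratio of \<open>n choose k\<close> and \<open>n + k choose k\<close>, and expand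
  \<open>H\<^sup>\<star>\<^sub>n(s)\<close> as \<open>\<Sum>k. c n k * F k\<close> with \<open>F\<close> independent of \<open>n\<close>. The empty index has
  \<open>F k = - 2 * (-1)^k\<close>. Since \<open>c n k - c (n - 1) k = (k / n)\<^sup>2 * c n k\<close>, putting a \<open>2\<close> in front
  of \<open>s\<close> divides \<open>F k\<close> by \<open>k\<^sup>2\<close>. Since \<open>(n - k) * c n k = (n + k + 1) * c n (k + 1)\<close>, putting a
  \<open>1\<close> in front of \<open>s\<close> replaces \<open>F k\<close> by \<open>(F k + 2 * (\<Sum>j<k. F j)) / k\<close>. The two
  summands are the two choices for the new leftmost \<open>\<circ>\<close>: merge or comma.
\<close>

section \<open>Binomial ratios and sums weighted by them\<close>

definition cbr :: "nat \<Rightarrow> nat \<Rightarrow> real" where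
  "cbr n k = real (n choose k) / real ((n + k) choose k)"

lemma cbr_fact: "k \<le> n \<Longrightarrow> cbr n k = fact n ^ 2 / (fact (n - k) * fact (n + k))"
  by (simp add: cbr_def binomial_fact power2_eq_square)

lemma cbr_eq_0: "n < k \<Longrightarrow> cbr n k = 0"
  by (simp add: cbr_def)

lemma cbr_0 [simp]: "cbr n 0 = 1"
  by (simp add: cbr_def)

lemma cbr_Suc_right: "k \<le> n \<Longrightarrow> real (n + k + 1) * cbr n (Suc k) = (real n - real k) * cbr n k"
proof (cases "k = n")
  case False
  assume "k \<le> n"
  with False obtain d where d: "n = k + Suc d"
    using less_imp_Suc_add by fastforce
  show ?thesis
    by (simp add: cbr_fact d divide_simps)
qed (simp add: cbr_eq_0)

lemma cbr_Suc_left: "real (Suc n) ^ 2 * cbr n k = (real (Suc n) ^ 2 - real k ^ 2) * cbr (Suc n) k"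
proof -
  consider "k \<le> n" | "k = Suc n" | "Suc n < k" by linarith
  then show ?thesis
  proof cases
    case 1
    then obtain d where d: "n = k + d" using le_Suc_ex by blast
    show ?thesis
      by (simp add: cbr_fact d divide_simps power2_eq_square del: of_nat_Suc)
        (simp add: algebra_simps)
  qed (simp_all add: cbr_eq_0)
qed

lemma alternating_sum_cbr:
  assumes "n \<ge> 1"
  shows "(\<Sum>k=1..n. cbr n k * (- 2 * (-1) ^ k)) = 1"
proof -
  \<comment> \<open>The remainder after \<open>m\<close> terms has a closed form by
    \<open>cbr_Suc_right\<close>. It vanishes at \<open>m = n\<close>, and \<open>n \<ge> 1\<close>
    allows cancelling the factor \<open>n\<close>.\<close>
  have "real n * (1 - (\<Sum>k=1..m. cbr n k * (- 2 * (-1) ^ k)))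
      = (-1) ^ m * ((real n - real m) * cbr n m)" if "m \<le> n" for m
    using that
  proof (induction m)
    case (Suc m)
    have "real n * (1 - (\<Sum>k=1..m. cbr n k * (- 2 * (-1) ^ k)))
        = (-1) ^ m * (real (n + m + 1) * cbr n (Suc m))"
      using Suc cbr_Suc_right[of m n] by simp
    thus ?case by (simp add: algebra_simps)
  qed simp
  from this[of n] assms show ?thesis by simp
qed

text \<open>Summation by parts: \<open>cbr_Suc_right\<close> absorbs the prefix sums into a boundary
  term. General \<open>m\<close> serves the induction; at \<open>m = n\<close> the boundary term
  drops out.\<close>

lemma sum_cbr_prefix:
  assumes "m \<le> n"
  shows "(\<Sum>k=1..m. real k * cbr n k * (F k + 2 * (\<Sum>j=1..k-1. F j)))
    = real n * (\<Sum>k=1..m. cbr n k * F k) - (real n - real m) * cbr n m * (\<Sum>k=1..m. F k)"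
  using assms
proof (induction m)
  case (Suc m)
  have "(\<Sum>k=1..m. real k * cbr n k * (F k + 2 * (\<Sum>j=1..k-1. F j)))
      = real n * (\<Sum>k=1..m. cbr n k * F k)
        - real (n + m + 1) * cbr n (Suc m) * (\<Sum>k=1..m. F k)"
    using Suc cbr_Suc_right[of m n] by simp
  thus ?case by (simp add: algebra_simps)
qed simp

section \<open>Expansions in binomial ratios\<close>

definition cbr_expansion :: "(nat \<Rightarrow> real) \<Rightarrow> (nat \<Rightarrow> real) \<Rightarrow> bool" where
  "cbr_expansion u F \<longleftrightarrow> (\<forall>n\<ge>1. u n = (\<Sum>k=1..n. cbr n k * F k))"

lemma cbr_expansion_cong:
  "cbr_expansion u F \<Longrightarrow> (\<And>k. k \<ge> 1 \<Longrightarrow> F k = G k) \<Longrightarrow> cbr_expansion u G"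
  unfolding cbr_expansion_def by (metis (no_types, lifting) atLeastAtMost_iff sum.cong)

text \<open>Both sides vanish at \<open>n = 0\<close> and have the same differences in \<open>n\<close>.\<close>

lemma cbr_expansion_sum:
  assumes "\<And>n. (\<Sum>k=1..Suc n. (real k / real (Suc n)) ^ 2 * cbr (Suc n) k * G k) = v (Suc n)"
  shows "cbr_expansion (\<lambda>n. \<Sum>m=1..n. v m) G"
proof -
  have "(\<Sum>m=1..n. v m) = (\<Sum>k=1..n. cbr n k * G k)" for n
  proof (induction n)
    case (Suc n)
    have "cbr (Suc n) k - cbr n k = (real k / real (Suc n)) ^ 2 * cbr (Suc n) k" for k
      using cbr_Suc_left[of n k] by (simp add: field_simps del: of_nat_Suc)
    \<comment> \<open>The sum for \<open>n\<close> may also run to \<open>Suc n\<close>, because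
      \<open>cbr n (Suc n) = 0\<close>.\<close>
    hence "(\<Sum>k=1..Suc n. cbr (Suc n) k * G k) - (\<Sum>k=1..Suc n. cbr n k * G k) = v (Suc n)"
      unfolding assms[symmetric] sum_subtractf[symmetric] by (metis left_diff_distrib)
    with Suc show ?case by (simp add: cbr_eq_0)
  qed simp
  thus ?thesis by (simp add: cbr_expansion_def)
qed

lemma cbr_expansion_2:
  assumes "cbr_expansion u F"
  shows "cbr_expansion (\<lambda>n. \<Sum>m=1..n. u m / real m ^ 2) (\<lambda>k. F k / real k ^ 2)"
proof (rule cbr_expansion_sum)
  fix n
  have "(\<Sum>k=1..Suc n. (real k / real (Suc n)) ^ 2 * cbr (Suc n) k * (F k / real k ^ 2))
      = (\<Sum>k=1..Suc n. cbr (Suc n) k * F k) / real (Suc n) ^ 2"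
    unfolding sum_divide_distrib by (intro sum.cong) (auto simp: field_simps simp del: of_nat_Suc)
  thus "(\<Sum>k=1..Suc n. (real k / real (Suc n)) ^ 2 * cbr (Suc n) k * (F k / real k ^ 2))
      = u (Suc n) / real (Suc n) ^ 2"
    using assms by (simp add: cbr_expansion_def)
qed

lemma cbr_expansion_1:
  assumes "cbr_expansion u F"
  shows "cbr_expansion (\<lambda>n. \<Sum>m=1..n. u m / real m)
    (\<lambda>k. (F k + 2 * (\<Sum>j=1..k-1. F j)) / real k)"
proof (rule cbr_expansion_sum)
  fix n
  let ?G = "\<lambda>k. F k + 2 * (\<Sum>j=1..k-1. F j)"
  have "(\<Sum>k=1..Suc n. (real k / real (Suc n)) ^ 2 * cbr (Suc n) k * (?G k / real k))
      = (\<Sum>k=1..Suc n. real k * cbr (Suc n) k * ?G k) / real (Suc n) ^ 2"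
    unfolding sum_divide_distrib
    by (intro sum.cong) (auto simp: power2_eq_square simp del: of_nat_Suc)
  also have "\<dots> = (\<Sum>k=1..Suc n. cbr (Suc n) k * F k) / real (Suc n)"
    unfolding sum_cbr_prefix[OF order_refl] by (simp add: power2_eq_square del: of_nat_Suc)
  finally show "(\<Sum>k=1..Suc n. (real k / real (Suc n)) ^ 2 * cbr (Suc n) k * (?G k / real k))
      = u (Suc n) / real (Suc n)"
    using assms by (simp add: cbr_expansion_def)
qed

section \<open>Recursions for harmonic sums in the first entry\<close>

lemma harm_term_Cons:
  "harm_term (x # s) (k # ks) = of_int (sgn x) ^ k / real k ^ nat \<bar>x\<bar> * harm_term s ks"
  unfolding harm_term_def by (simp only: length_Cons prod.lessThan_Suc_shift nth_Cons_0 nth_Cons_Suc)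

lemma finite_index_lists: "finite {ks :: nat list. length ks = l \<and> set ks \<subseteq> {1..n} \<and> P ks}"
  by (rule finite_subset[OF _ finite_lists_length_eq[of "{1..n}" l]]) auto

lemma mhs_Nil [simp]: "mhs n [] = 1"
proof -
  have "{ks :: nat list. length ks = 0 \<and> set ks \<subseteq> {1..n} \<and> sorted_wrt (>) ks} = {[]}" by auto
  thus ?thesis by (simp add: mhs_def harm_term_def)
qed

lemma mhs_star_Nil [simp]: "mhs_star n [] = 1"
proof -
  have "{ks :: nat list. length ks = 0 \<and> set ks \<subseteq> {1..n} \<and> sorted_wrt (\<ge>) ks} = {[]}" by auto
  thus ?thesis by (simp add: mhs_star_def harm_term_def)
qed

text \<open>Split off the largest summation variable \<open>k\<close>; strictness confines the
  remaining ones to \<open>{1..k - 1}\<close>. In the star version below they may also equal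
  \<open>k\<close>.\<close>

lemma mhs_Cons:
  "mhs n (x # s) = (\<Sum>k=1..n. of_int (sgn x) ^ k / real k ^ nat \<bar>x\<bar> * mhs (k - 1) s)"
proof -
  let ?A = "\<lambda>n s. {ks. length ks = length (s :: int list) \<and> set ks \<subseteq> {1..n} \<and> sorted_wrt (>) ks}"
  let ?B = "SIGMA k:{1..n}. ?A (k - 1) s"
  have "k # ks \<in> ?A n (x # s) \<longleftrightarrow> (k, ks) \<in> ?B" for k ks
  proof -
    have "{1..k - 1} = {1..<k}" if "k \<ge> 1"
      using that by auto
    thus ?thesis by (fastforce simp: subset_iff)
  qed
  hence "?A n (x # s) = (\<lambda>(k, ks). k # ks) ` ?B"
    by (fastforce simp: length_Suc_conv image_iff)
  moreover have "inj_on (\<lambda>(k, ks). k # ks) ?B"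
    by (auto intro: inj_onI)
  ultimately have "mhs n (x # s) = (\<Sum>(k, ks)\<in>?B. harm_term (x # s) (k # ks))"
    by (simp add: mhs_def sum.reindex case_prod_unfold)
  also have "\<dots> = (\<Sum>k=1..n. \<Sum>ks\<in>?A (k - 1) s. harm_term (x # s) (k # ks))"
    by (intro sum.Sigma[symmetric] ballI finite_atLeastAtMost finite_index_lists)
  finally show ?thesis
    by (simp add: harm_term_Cons mhs_def sum_distrib_left)
qed

lemma mhs_star_Cons:
  "mhs_star n (x # s) = (\<Sum>k=1..n. of_int (sgn x) ^ k / real k ^ nat \<bar>x\<bar> * mhs_star k s)"
proof -
  let ?A = "\<lambda>n s. {ks. length ks = length (s :: int list) \<and> set ks \<subseteq> {1..n} \<and> sorted_wrt (\<ge>) ks}"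
  let ?B = "SIGMA k:{1..n}. ?A k s"
  have "k # ks \<in> ?A n (x # s) \<longleftrightarrow> (k, ks) \<in> ?B" for k ks
    by (auto simp: subset_iff)
  hence "?A n (x # s) = (\<lambda>(k, ks). k # ks) ` ?B"
    by (fastforce simp: length_Suc_conv image_iff)
  moreover have "inj_on (\<lambda>(k, ks). k # ks) ?B"
    by (auto intro: inj_onI)
  ultimately have "mhs_star n (x # s) = (\<Sum>(k, ks)\<in>?B. harm_term (x # s) (k # ks))"
    by (simp add: mhs_star_def sum.reindex case_prod_unfold)
  also have "\<dots> = (\<Sum>k=1..n. \<Sum>ks\<in>?A k s. harm_term (x # s) (k # ks))"
    by (intro sum.Sigma[symmetric] ballI finite_atLeastAtMost finite_index_lists)
  finally show ?thesis
    by (simp add: harm_term_Cons mhs_star_def sum_distrib_left)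
qed

lemma cbr_expansion_replicate_2:
  assumes "cbr_expansion (\<lambda>n. mhs_star n s) F"
  shows "cbr_expansion (\<lambda>n. mhs_star n (replicate a 2 @ s)) (\<lambda>k. F k / real k ^ (2 * a))"
proof (induction a)
  case (Suc a)
  from cbr_expansion_2[OF this] show ?case
    by (simp add: mhs_star_Cons power2_eq_square mult_ac)
qed (simp add: assms)

section \<open>Merging entries of an index\<close>

lemma oplus_pos: "x > 0 \<Longrightarrow> y \<noteq> 0 \<Longrightarrow> oplus x y = sgn y * (x + \<bar>y\<bar>)"
  by (auto simp: oplus_def sgn_if)

text \<open>On nonzero integers \<open>oplus\<close> multiplies signs and adds absolute values, and
  both operations are associative.\<close>

lemma oplus_assoc: "x > 0 \<Longrightarrow> y \<noteq> 0 \<Longrightarrow> z \<noteq> 0 \<Longrightarrow> oplus (oplus x y) z = oplus x (oplus y z)"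
  by (auto simp: oplus_def sgn_if)

lemma oplus_neq_0: "x \<noteq> 0 \<Longrightarrow> y \<noteq> 0 \<Longrightarrow> oplus x y \<noteq> 0"
  by (auto simp: oplus_def sgn_if)

lemma finite_merges [simp]: "finite (merges L)"
  by (induction L rule: merges.induct) auto

lemma merges_nonzero: "0 \<notin> set L \<Longrightarrow> p \<in> merges L \<Longrightarrow> p \<noteq> [] \<and> 0 \<notin> set p"
proof (induction L arbitrary: p rule: merges.induct)
  case (3 s t ss)
  have "0 \<notin> set (t # ss)" "0 \<notin> set (oplus s t # ss)" "s \<noteq> 0"
    using "3.prems"(1) oplus_neq_0[of s t] by auto
  note IH = "3.IH"(1)[OF this(1)] "3.IH"(2)[OF this(2)]
  from "3.prems"(2) consider q where "q \<in> merges (t # ss)" "p = s # q"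
    | "p \<in> merges (oplus s t # ss)"
    by (auto simp only: merges.simps)
  thus ?case
    using IH \<open>s \<noteq> 0\<close> by cases auto
qed auto

definition merge_hd :: "int \<Rightarrow> int list \<Rightarrow> int list" where
  "merge_hd x p = oplus x (hd p) # tl p"

text \<open>Since \<open>merges\<close> brackets to the left, \<open>x\<close> enters before the
  later choices are made; associativity moves it to the head of each finished index.\<close>

lemma merges_oplus:
  assumes "x > 0" "0 \<notin> set (t # ss)"
  shows "merges (oplus x t # ss) = merge_hd x ` merges (t # ss)"
  using assms(2)
proof (induction "t # ss" arbitrary: t ss rule: merges.induct)
  case (3 t u ss)
  have "oplus (oplus x t) u = oplus x (oplus t u)"
    using 3 assms(1) by (simp add: oplus_assoc)
  moreover have "merges (oplus x (oplus t u) # ss) = merge_hd x ` merges (oplus t u # ss)"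
    using 3 oplus_neq_0[of t u] by auto
  ultimately show ?case
    by (simp add: image_Un image_image merge_hd_def)
qed (simp add: merge_hd_def)

text \<open>The coefficient of \<open>cbr n k\<close> in the right-hand side of the theorem.\<close>

definition merges_coeff :: "int list \<Rightarrow> nat \<Rightarrow> real" where
  "merges_coeff L k = - (\<Sum>p\<in>merges L. 2 ^ length p *
     (of_int (sgn (hd p)) ^ k / real k ^ nat \<bar>hd p\<bar> * mhs (k - 1) (tl p)))"

text \<open>A comma adds a component, hence the factor 2, and turns the old head into a summand of
  an inner sum over \<open>j < k\<close>. Merging keeps the length and only adds \<open>x\<close> to
  the exponent of \<open>k\<close>. As \<open>x > 0\<close>, no sign changes.\<close>

lemma merges_coeff_Cons:
  assumes "x > 0" "L \<noteq> []" "0 \<notin> set L"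
  shows "merges_coeff (x # L) k
    = (merges_coeff L k + 2 * (\<Sum>j=1..k-1. merges_coeff L j)) / real k ^ nat x"
proof -
  define T where "T p k = (2::real) ^ length p *
     (of_int (sgn (hd p)) ^ k / real k ^ nat \<bar>hd p\<bar> * mhs (k - 1) (tl p))" for p k
  have coeff: "merges_coeff M j = - (\<Sum>p\<in>merges M. T p j)" for M j
    by (simp add: merges_coeff_def T_def)
  note nz = merges_nonzero[OF assms(3)]
  have merges: "merges (x # L) = (#) x ` merges L \<union> merge_hd x ` merges L"
    using assms merges_oplus[of x "hd L" "tl L"] by (cases L) auto
  have abs: "\<bar>oplus x (hd p)\<bar> = x + \<bar>hd p\<bar>" "sgn (oplus x (hd p)) = sgn (hd p)" "hd p \<noteq> 0"
    if "p \<in> merges L" for p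
    using nz[OF that] assms(1) oplus_pos[of x "hd p"]
    by (cases p; auto simp: sgn_if)+
  \<comment> \<open>The head is \<open>x\<close> after a comma, but has absolute value greater than
    \<open>x\<close> after a merge.\<close>
  have disj: "(#) x ` merges L \<inter> merge_hd x ` merges L = {}"
    using abs assms(1) by (fastforce simp: merge_hd_def)
  have inj: "inj_on (merge_hd x) (merges L)"
  proof (rule inj_onI)
    fix p q assume pq: "p \<in> merges L" "q \<in> merges L" "merge_hd x p = merge_hd x q"
    hence "\<bar>hd p\<bar> = \<bar>hd q\<bar>" "sgn (hd p) = sgn (hd q)" "tl p = tl q"
      using abs[of p] abs[of q] by (auto simp: merge_hd_def)
    thus "p = q"
      using nz[OF pq(1)] nz[OF pq(2)] by (metis list.expand mult_sgn_abs)
  qed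
  have comma: "T (x # p) k = 2 * (\<Sum>j=1..k-1. T p j) / real k ^ nat x" if "p \<in> merges L" for p
    using nz[OF that] assms(1)
    by (cases p) (simp_all add: T_def mhs_Cons sum_distrib_left sum_divide_distrib mult_ac)
  have merge: "T (merge_hd x p) k = T p k / real k ^ nat x" if "p \<in> merges L" for p
    using nz[OF that] abs[OF that] assms(1)
    by (cases p) (simp_all add: T_def merge_hd_def nat_add_distrib power_add)
  have "(\<Sum>p\<in>merges (x # L). T p k)
      = (\<Sum>p\<in>merges L. T (x # p) k) + (\<Sum>p\<in>merges L. T (merge_hd x p) k)"
    unfolding merges using disj inj by (simp add: sum.union_disjoint sum.reindex)
  also have "\<dots> = (\<Sum>p\<in>merges L. 2 * (\<Sum>j=1..k-1. T p j) / real k ^ nat x)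
      + (\<Sum>p\<in>merges L. T p k / real k ^ nat x)"
    by (simp only: comma merge cong: sum.cong)
  also have "\<dots> = (2 * (\<Sum>p\<in>merges L. \<Sum>j=1..k-1. T p j) + (\<Sum>p\<in>merges L. T p k)) / real k ^ nat x"
    by (simp add: sum_divide_distrib sum_distrib_left add_divide_distrib)
  also have "(\<Sum>p\<in>merges L. \<Sum>j=1..k-1. T p j) = (\<Sum>j=1..k-1. \<Sum>p\<in>merges L. T p j)"
    by (rule sum.swap)
  finally show ?thesis
    by (simp add: coeff sum_negf minus_divide_left)
qed

section \<open>Induction over the blocks, starting from the last one\<close>

lemma cbr_expansion_mhs_star:
  assumes "b \<ge> 1"
  shows "cbr_expansion
    (\<lambda>n. mhs_star n (concat (map (\<lambda>a. replicate a 2 @ [1]) as) @ replicate b 2))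
    (merges_coeff (map (\<lambda>a. 2 * int a + 1) as @ [- (2 * int b)]))"
proof (induction as)
  case Nil
  \<comment> \<open>This base identity fails at \<open>n = 0\<close>, where the sum is empty but the
    left side is 1; hence the restriction to \<open>n \<ge> 1\<close> in
    \<open>cbr_expansion\<close>.\<close>
  have "cbr_expansion (\<lambda>n. mhs_star n []) (\<lambda>k. - 2 * (-1) ^ k)"
    unfolding cbr_expansion_def mhs_star_Nil
    by (intro allI impI alternating_sum_cbr[symmetric])
  from cbr_expansion_replicate_2[OF this, of b]
  have "cbr_expansion (\<lambda>n. mhs_star n (replicate b 2)) (merges_coeff [- (2 * int b)])"
    unfolding append_Nil2
  proof (rule cbr_expansion_cong)
    fix k :: nat
    \<comment> \<open>The single component gives the factor 2, and its bar gives
      \<open>(-1) ^ k\<close>; \<open>b \<ge> 1\<close> ensures that the entry really is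
      negative.\<close>
    show "- 2 * (-1) ^ k / real k ^ (2 * b) = merges_coeff [- (2 * int b)] k"
      using assms by (simp add: merges_coeff_def nat_mult_distrib sgn_minus)
  qed
  thus ?case by simp
next
  case (Cons a as)
  let ?s = "concat (map (\<lambda>a. replicate a 2 @ [1]) as) @ replicate b (2::int)"
  let ?L = "map (\<lambda>a. 2 * int a + 1) as @ [- (2 * int b)]"
  have "cbr_expansion (\<lambda>n. mhs_star n (1 # ?s))
      (\<lambda>k. (merges_coeff ?L k + 2 * (\<Sum>j=1..k-1. merges_coeff ?L j)) / real k)"
    using cbr_expansion_1[OF Cons] by (simp add: mhs_star_Cons)
  from cbr_expansion_replicate_2[OF this, of a]
  have "cbr_expansion (\<lambda>n. mhs_star n (replicate a 2 @ 1 # ?s)) (merges_coeff ((2 * int a + 1) # ?L))"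
  proof (rule cbr_expansion_cong)
    fix k :: nat
    have "0 \<notin> set ?L" using assms by auto
    \<comment> \<open>The new 1 and the \<open>a\<close> twos together contribute the exponent
      \<open>2 * a + 1\<close>, which is the entry prepended to \<open>?L\<close>.\<close>
    moreover have "nat (2 * int a + 1) = Suc (2 * a)" by simp
    ultimately show "(merges_coeff ?L k + 2 * (\<Sum>j=1..k-1. merges_coeff ?L j)) / real k
        / real k ^ (2 * a) = merges_coeff ((2 * int a + 1) # ?L) k"
      by (subst merges_coeff_Cons) simp_all
  qed
  thus ?case by simp
qed

theorem theorem2p3:
  fixes r n :: nat and a :: "nat \<Rightarrow> nat" and s :: "int list"
  assumes "a (r + 1) \<ge> 1"
    and "n \<ge> 1"
    and "s = concat (map (\<lambda>i. replicate (a i) 2 @ [1]) [1..<r + 1]) @ replicate (a (r + 1)) 2"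
  shows "mhs_star n s =
    - (\<Sum>p \<in> merges (map (\<lambda>i. 2 * int (a i) + 1) [1..<r + 1] @ [- (2 * int (a (r + 1)))]).
         2 ^ length p * binom_mhs n p)"
proof -
  let ?L = "map (\<lambda>i. 2 * int (a i) + 1) [1..<r + 1] @ [- (2 * int (a (r + 1)))]"
  have "mhs_star n s = (\<Sum>k=1..n. cbr n k * merges_coeff ?L k)"
    using cbr_expansion_mhs_star[OF assms(1), of "map a [1..<r + 1]"] assms(2)
    unfolding cbr_expansion_def map_map comp_def assms(3) by (elim allE impE)
  also have "\<dots> = - (\<Sum>k=1..n. \<Sum>p\<in>merges ?L. 2 ^ length p * (of_int (sgn (hd p)) ^ k
      / real k ^ nat \<bar>hd p\<bar> * cbr n k * mhs (k - 1) (tl p)))"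
    by (simp only: merges_coeff_def sum_distrib_left sum_negf mult_minus_right mult_ac times_divide_eq_right)
  \<comment> \<open>With the sum over \<open>p\<close> outermost, the inner sum over
    \<open>k\<close> is \<open>binom_mhs n p\<close> up to its weight.\<close>
  also have "\<dots> = - (\<Sum>p\<in>merges ?L. 2 ^ length p * binom_mhs n p)"
    by (subst sum.swap) (simp only: binom_mhs_def cbr_def sum_distrib_left)
  finally show ?thesis .
qed

end
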